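(* Let $F \in \mathrm{Sym}^d(\mathbb{C}^2)$ with $\mathrm{rk}(F)=3$. Suppose $[L] \in \mathcal{W}(F) \cap \mathrm{Eig}(F)$, that $L$ appears with coefficient $\alpha$ in a minimal Waring decomposition $F=\alpha L^d+\beta_2L_2^d+\beta_3L_3^d$ of $F$ (with $L_2,L_3$ linear forms and $\beta_2,\beta_3\in\mathbb{C}$), and that $\mu$ is the singular value of $L$ as eigenvector of $F$. Then $\mu \neq \alpha$ and $L$ is not isotropic. Moreover, if $d \geq 4$, then $\mathrm{Ann}(F-\mu L^d)=(L^\perp L_2^\perp L_3^\perp,\,L^{d-1})$.
   Context: Work over $\mathbb{C}$; $\mathrm{Sym}^d(\mathbb{C}^2)=\mathbb{C}[x_0,x_1]_d$, and a linear form $a_0x_0+a_1x_1$ is identified with $(a_0,a_1)\in\mathbb{C}^2$. The Waring rank $\mathrm{rk}(F)$ is the minimal $r$ such that $F=\sum_{i=1}^rL_i^d$ with $L_i$ linear. The Waring locus $\mathcal{W}(F)$ is the set of $[L]\in\mathbb{P}(\mathrm{Sym}^1(\mathbb{C}^2))$ with $F\in\langle L^d,L_2^d,\dots,L_r^d\rangle$ for some linear forms $L_2,\dots,L_r$, $r=\mathrm{rk}(F)$. The apolar action is $G\circ F=G(\partial_0,\partial_1)F(x_0,x_1)$, where a polynomial $G$ in $x_0,x_1$ acts via $x_i\mapsto\partial_i=\partial/\partial x_i$; $\mathrm{Ann}(F)=\{G\mid G\circ F=0\}$ is the apolar ideal (polynomials in $x_i$ are regarded as elements via $x_i\mapsto\partial_i$).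 Let $\langle u,v\rangle_{\mathbb{C}}=u_0v_0+u_1v_1$; $L$ is isotropic if $\langle L,L\rangle_{\mathbb{C}}=0$. The Bombieri-Weyl product on $\mathrm{Sym}^d(\mathbb{C}^2)$ is the bilinear form determined by $\langle u^d,v^d\rangle=(\langle u,v\rangle_{\mathbb{C}})^d$. A nonzero linear form $L$ is an eigenvector of $F$ with singular value $\lambda\in\mathbb{C}$ if $\langle F-\lambda L^d,L^{d-1}M\rangle=0$ for every linear form $M$, equivalently $L^{d-1}\circ(F-\lambda L^d)=0$. $\mathrm{Eig}(F)$ consists of all $[L]$ with $L$ an eigenvector of $F$. For a nonzero linear form $L$, $L^\perp$ denotes the linear form, unique up to scalar, with $L^\perp\circ L=\langle L^\perp,L\rangle_{\mathbb{C}}=0$. *)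

theory Defs
  imports Complex_Main "HOL-Computational_Algebra.Polynomial"
begin

text \<open>
  \<open>\<complex>[x\<^sub>0,x\<^sub>1]\<close> is \<^typ>\<open>complex poly poly\<close>, read as \<open>(\<complex>[x\<^sub>0])[x\<^sub>1]\<close>:
  the outer indeterminate is \<open>x\<^sub>1\<close> and the inner one is \<open>x\<^sub>0\<close>.
\<close>

text \<open>The coefficient of \<open>x\<^sub>0\<^sup>i x\<^sub>1\<^sup>j\<close>.\<close>
definition coeff2 :: "complex poly poly \<Rightarrow> nat \<Rightarrow> nat \<Rightarrow> complex" where
  "coeff2 p i j = coeff (coeff p j) i"

definition cscale :: "complex \<Rightarrow> complex poly poly \<Rightarrow> complex poly poly" where
  "cscale c p = smult [:c:] p"

definition Sym :: "nat \<Rightarrow> complex poly poly set" where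
  "Sym d = {p. \<forall>i j. coeff2 p i j \<noteq> 0 \<longrightarrow> i + j = d}"

global_interpretation form: vector_space cscale
  by standard
    (simp_all add: cscale_def smult_add_right mult.commute flip: smult_add_left one_pCons)

text \<open>\<open>ideal.span S\<close> is the ideal of \<open>\<complex>[x\<^sub>0,x\<^sub>1]\<close> generated by \<open>S\<close>.\<close>
global_interpretation ideal: module "(*) :: complex poly poly \<Rightarrow> complex poly poly \<Rightarrow> complex poly poly"
  by standard (simp_all add: algebra_simps)

text \<open>The projective point \<open>[L]\<close>, as the line through \<open>L\<close>.\<close>
definition proj :: "complex poly poly \<Rightarrow> complex poly poly set" where
  "proj L = form.span {L}"

text \<open>For \<open>d \<ge> 1\<close> every \<open>F \<in> Sym d\<close> is a sum of \<open>d\<close>-th powers of linear forms, so the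
  minimum exists.\<close>
definition waring_rank :: "nat \<Rightarrow> complex poly poly \<Rightarrow> nat" where
  "waring_rank d F = (LEAST r. \<exists>L. (\<forall>i\<in>{1..r}. L i \<in> Sym 1) \<and> F = (\<Sum>i=1..r. L i ^ d))"

definition waring_locus :: "nat \<Rightarrow> complex poly poly \<Rightarrow> complex poly poly set set" where
  "waring_locus d F = {proj L | L. L \<in> Sym 1 \<and> L \<noteq> 0 \<and>
     (\<exists>M. (\<forall>i\<in>{2..waring_rank d F}. M i \<in> Sym 1) \<and>
          F \<in> form.span (insert (L ^ d) ((\<lambda>i. M i ^ d) ` {2..waring_rank d F})))}"

definition D0 :: "complex poly poly \<Rightarrow> complex poly poly" where
  "D0 p = map_poly pderiv p"

definition D1 :: "complex poly poly \<Rightarrow> complex poly poly" where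
  "D1 p = pderiv p"

definition apolar :: "complex poly poly \<Rightarrow> complex poly poly \<Rightarrow> complex poly poly" where
  "apolar G F = (\<Sum>j\<le>degree G. \<Sum>i\<le>degree (coeff G j).
     cscale (coeff2 G i j) ((D0 ^^ i) ((D1 ^^ j) F)))"

definition Ann :: "complex poly poly \<Rightarrow> complex poly poly set" where
  "Ann F = {G. apolar G F = 0}"

definition cpair :: "complex poly poly \<Rightarrow> complex poly poly \<Rightarrow> complex" where
  "cpair u v = coeff2 u 1 0 * coeff2 v 1 0 + coeff2 u 0 1 * coeff2 v 0 1"

definition isotropic :: "complex poly poly \<Rightarrow> bool" where
  "isotropic L \<longleftrightarrow> cpair L L = 0"

definition is_perp :: "complex poly poly \<Rightarrow> complex poly poly \<Rightarrow> bool" where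
  "is_perp P L \<longleftrightarrow> P \<in> Sym 1 \<and> P \<noteq> 0 \<and> cpair P L = 0"

text \<open>The Bombieri-Weyl product in coordinates. The lemmas \<open>bw_power\<close>, \<open>bw_bilinear\<close> and
  \<open>bw_unique\<close> below show that it is the bilinear form on \<open>Sym d\<close> determined by
  \<open>\<langle>u\<^sup>d,v\<^sup>d\<rangle> = \<langle>u,v\<rangle>\<^sup>d\<close> for linear forms \<open>u\<close>, \<open>v\<close>.\<close>
definition bw :: "nat \<Rightarrow> complex poly poly \<Rightarrow> complex poly poly \<Rightarrow> complex" where
  "bw d F G = (\<Sum>i\<le>d. coeff2 F i (d - i) * coeff2 G i (d - i) / of_nat (d choose i))"

definition is_eigenvector ::
    "nat \<Rightarrow> complex poly poly \<Rightarrow> complex poly poly \<Rightarrow> complex \<Rightarrow> bool" where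
  "is_eigenvector d F L lam \<longleftrightarrow> L \<in> Sym 1 \<and> L \<noteq> 0 \<and>
     (\<forall>M\<in>Sym 1. bw d (F - cscale lam (L ^ d)) (L ^ (d - 1) * M) = 0)"

definition Eig :: "nat \<Rightarrow> complex poly poly \<Rightarrow> complex poly poly set set" where
  "Eig d F = {proj L | L. \<exists>lam. is_eigenvector d F L lam}"


lemma coeff2_simps:
  "coeff2 (p + q) i j = coeff2 p i j + coeff2 q i j"
  "coeff2 (cscale c p) i j = c * coeff2 p i j"
  "coeff2 0 i j = 0"
  by (simp_all add: coeff2_def cscale_def)

lemma poly2_eqI: "(\<And>i j. coeff2 p i j = coeff2 q i j) \<Longrightarrow> p = q"
  by (simp add: coeff2_def poly_eq_iff)

lemma coeff2_sum: "coeff2 (sum f A) i j = (\<Sum>x\<in>A. coeff2 (f x) i j)"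
  by (simp add: coeff2_def coeff_sum)

lemma Sym1_eq:
  assumes "u \<in> Sym 1"
  shows "u = monom [:coeff2 u 0 1:] 1 + [:monom (coeff2 u 1 0) 1:]"
proof (rule poly2_eqI)
  fix i j
  have "coeff2 u i j = 0" if "i + j \<noteq> 1" using assms that by (auto simp: Sym_def)
  then show "coeff2 u i j = coeff2 (monom [:coeff2 u 0 1:] 1 + [:monom (coeff2 u 1 0) 1:]) i j"
    by (cases i; cases j) (auto simp: coeff2_def coeff_pCons split: nat.splits)
qed

lemma Sym1_linear: "monom [:b:] 1 + [:monom a 1:] \<in> Sym 1"
  by (auto simp: Sym_def coeff2_def coeff_pCons split: nat.splits if_splits)

lemma coeff2_linear_power:
  "coeff2 ((monom [:b:] 1 + [:monom a 1:]) ^ d) i j =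
     (if i + j = d then of_nat (d choose i) * a ^ i * b ^ j else 0)"
proof -
  have pow: "[:monom a 1:] ^ n = monom (monom (a ^ n) n) 0" for n
    by (simp add: monom_power poly_const_pow flip: monom_0)
  have pow': "monom [:b:] 1 ^ n = monom (monom (b ^ n) 0) n" for n
    by (simp add: monom_power poly_const_pow monom_0)
  have nat: "of_nat n = monom (monom (of_nat n :: complex) 0) 0" for n
    by (simp add: of_nat_poly monom_0)
  have "(monom [:b:] 1 + [:monom a 1:]) ^ d =
      (\<Sum>k\<le>d. of_nat (d choose k) * monom [:b:] 1 ^ k * [:monom a 1:] ^ (d - k))"
    by (rule binomial_ring)
  also have "\<dots> = (\<Sum>k\<le>d. monom (monom (of_nat (d choose k) * b ^ k * a ^ (d - k)) (d - k)) k)"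
    unfolding pow pow' nat mult_monom by simp
  finally have "coeff2 ((monom [:b:] 1 + [:monom a 1:]) ^ d) i j =
      (\<Sum>k\<le>d. if k = j then (if i = d - k then of_nat (d choose k) * b ^ k * a ^ (d - k) else 0) else 0)"
    by (simp only: coeff2_sum) (intro sum.cong refl, auto simp: coeff2_def)
  also have "\<dots> = (if i + j = d then of_nat (d choose i) * a ^ i * b ^ j else 0)"
    by (subst sum.delta) (auto simp: binomial_symmetric[of j])
  finally show ?thesis .
qed

lemma bw_power:
  assumes "u \<in> Sym 1" "v \<in> Sym 1"
  shows "bw d (u ^ d) (v ^ d) = cpair u v ^ d"
proof -
  define a b a' b' where "a = coeff2 u 1 0" "b = coeff2 u 0 1" "a' = coeff2 v 1 0" "b' = coeff2 v 0 1"
  note ab = this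
  have uv: "u = monom [:b:] 1 + [:monom a 1:]" "v = monom [:b':] 1 + [:monom a' 1:]"
    using assms Sym1_eq ab by auto
  have "bw d (u ^ d) (v ^ d) = (\<Sum>i\<le>d. of_nat (d choose i) * (a * a') ^ i * (b * b') ^ (d - i))"
    unfolding bw_def uv coeff2_linear_power
    by (intro sum.cong refl) (simp add: power_mult_distrib field_simps)
  also have "\<dots> = cpair u v ^ d"
    by (simp add: cpair_def ab flip: binomial_ring)
  finally show ?thesis .
qed

lemma bw_bilinear:
  "bw d (F + F') G = bw d F G + bw d F' G"
  "bw d F (G + G') = bw d F G + bw d F G'"
  "bw d (cscale c F) G = c * bw d F G"
  "bw d F (cscale c G) = c * bw d F G"
  by (simp_all add: bw_def coeff2_simps sum_distrib_left algebra_simps add_divide_distrib sum.distrib)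

lemma coeffs_in_subspace:
  assumes W: "form.subspace W"
    and "\<And>t. (\<Sum>i\<le>n. cscale (t ^ i) (v i)) \<in> W" "i \<le> n"
  shows "v i \<in> W"
  using assms(2,3)
proof (induction n arbitrary: v i)
  case 0
  then show ?case using "0.prems"(1)[of 1] by simp
next
  case (Suc n)
  have small: "v i \<in> W" if "i \<le> n" for i
  proof -
    define w where "w i = cscale (2 ^ i - 2 ^ Suc n) (v i)" for i
    have "(\<Sum>i\<le>n. cscale (t ^ i) (w i)) \<in> W" for t
    proof -
      have "(\<Sum>i\<le>n. cscale (t ^ i) (w i)) = (\<Sum>i\<le>Suc n. cscale (t ^ i) (w i))"
        by (simp add: w_def)
      also have "\<dots> = (\<Sum>i\<le>Suc n. cscale ((2 * t) ^ i) (v i) - cscale (2 ^ Suc n) (cscale (t ^ i) (v i)))"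
        unfolding w_def form.scale_scale form.scale_left_diff_distrib[symmetric]
        by (intro sum.cong refl arg_cong2[where f = cscale]) (simp add: power_mult_distrib algebra_simps)
      also have "\<dots> = (\<Sum>i\<le>Suc n. cscale ((2 * t) ^ i) (v i)) -
          cscale (2 ^ Suc n) (\<Sum>i\<le>Suc n. cscale (t ^ i) (v i))"
        by (simp only: sum_subtractf form.scale_sum_right)
      also have "\<dots> \<in> W"
        by (intro form.subspace_diff form.subspace_scale W Suc.prems)
      finally show ?thesis .
    qed
    then have "w i \<in> W" using Suc.IH that by blast
    then have "cscale (inverse (2 ^ i - 2 ^ Suc n)) (w i) \<in> W"
      by (rule form.subspace_scale[OF W])
    moreover have "(2::complex) ^ i - 2 ^ Suc n \<noteq> 0"
    proof
      assume "(2::complex) ^ i - 2 ^ Suc n = 0"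
      then have "of_nat (2 ^ i) = (of_nat (2 ^ Suc n) :: complex)" by simp
      then have "(2::nat) ^ i = 2 ^ Suc n" by (simp only: of_nat_eq_iff)
      then have "i = Suc n" by (simp only: power_inject_exp)
      then show False using that by simp
    qed
    ultimately show ?thesis by (simp add: w_def)
  qed
  have "v (Suc n) = (\<Sum>i\<le>Suc n. cscale (1 ^ i) (v i)) - (\<Sum>i\<le>n. v i)"
    by simp
  also have "\<dots> \<in> W"
    by (intro form.subspace_diff form.subspace_sum W Suc.prems(1) small) auto
  finally have "v (Suc n) \<in> W" .
  with small Suc.prems(2) show ?case by (metis le_Suc_eq)
qed

lemma Sym_span_powers: "Sym d \<subseteq> form.span {u ^ d | u. u \<in> Sym 1}"
proof
  fix F assume F: "F \<in> Sym d"
  define W where "W = form.span {u ^ d | u. u \<in> Sym 1}"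
  define v where "v j = cscale (of_nat (d choose j)) (monom (monom 1 (d - j)) j)" for j
  have W: "form.subspace W" by (simp add: W_def form.subspace_span)
  have cv: "coeff2 (v k) i j = (if k = j then (if i = d - j then of_nat (d choose j) else 0) else 0)"
    for k i j
    by (simp add: v_def coeff2_simps) (simp add: coeff2_def)
  have csum: "coeff2 (\<Sum>k\<le>d. cscale (c k) (v k)) i j =
      (if i + j = d then c j * of_nat (d choose j) else 0)" for c i j
  proof -
    have "coeff2 (\<Sum>k\<le>d. cscale (c k) (v k)) i j =
        (\<Sum>k\<le>d. if k = j then (if i = d - j then c j * of_nat (d choose j) else 0) else 0)"
      unfolding coeff2_sum coeff2_simps cv by (intro sum.cong refl) simp
    also have "\<dots> = (if i + j = d then c j * of_nat (d choose j) else 0)"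
      by (subst sum.delta) auto
    finally show ?thesis .
  qed
  have "(\<Sum>j\<le>d. cscale (t ^ j) (v j)) = (monom [:t:] 1 + [:monom 1 1:]) ^ d" for t
  proof (rule poly2_eqI)
    fix i j
    have "d choose j = d choose i" if "i + j = d"
      using binomial_symmetric[of j d] that by auto
    then show "coeff2 (\<Sum>j\<le>d. cscale (t ^ j) (v j)) i j =
        coeff2 ((monom [:t:] 1 + [:monom 1 1:]) ^ d) i j"
      unfolding coeff2_linear_power csum by simp
  qed
  moreover have "(monom [:t:] 1 + [:monom 1 1:]) ^ d \<in> W" for t
    unfolding W_def by (intro form.span_base) (use Sym1_linear in blast)
  ultimately have v: "v j \<in> W" if "j \<le> d" for j
    using coeffs_in_subspace[OF W, where n = d and v = v] that by simp
  have "F = (\<Sum>j\<le>d. cscale (coeff2 F (d - j) j / of_nat (d choose j)) (v j))"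
  proof (rule poly2_eqI)
    fix i j
    have "coeff2 F i j = 0" if "i + j \<noteq> d" using F that by (auto simp: Sym_def)
    then show "coeff2 F i j =
        coeff2 (\<Sum>j\<le>d. cscale (coeff2 F (d - j) j / of_nat (d choose j)) (v j)) i j"
      unfolding csum by auto
  qed
  also have "\<dots> \<in> W"
    by (intro form.subspace_sum form.subspace_scale W v) auto
  finally show "F \<in> form.span {u ^ d | u. u \<in> Sym 1}" by (simp add: W_def)
qed

lemma Sym_power: "u \<in> Sym 1 \<Longrightarrow> u ^ d \<in> Sym d"
  by (subst Sym1_eq, assumption) (auto simp only: Sym_def coeff2_linear_power mem_Collect_eq split: if_splits)

lemma Sym_subspace: "form.subspace (Sym d)"
  by (rule form.subspaceI) (auto simp: Sym_def coeff2_simps, force)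

lemma bw_unique:
  assumes B: "\<And>F F' G. \<lbrakk>F \<in> Sym d; F' \<in> Sym d; G \<in> Sym d\<rbrakk> \<Longrightarrow> B (F + F') G = B F G + B F' G"
      "\<And>F G G'. \<lbrakk>F \<in> Sym d; G \<in> Sym d; G' \<in> Sym d\<rbrakk> \<Longrightarrow> B F (G + G') = B F G + B F G'"
      "\<And>c F G. \<lbrakk>F \<in> Sym d; G \<in> Sym d\<rbrakk> \<Longrightarrow> B (cscale c F) G = c * B F G"
      "\<And>c F G. \<lbrakk>F \<in> Sym d; G \<in> Sym d\<rbrakk> \<Longrightarrow> B F (cscale c G) = c * B F G"
    and pow: "\<And>u v. \<lbrakk>u \<in> Sym 1; v \<in> Sym 1\<rbrakk> \<Longrightarrow> B (u ^ d) (v ^ d) = cpair u v ^ d"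
    and F: "F \<in> Sym d" and G: "G \<in> Sym d"
  shows "B F G = bw d F G"
proof -
  note S = Sym_subspace[of d]
  have zero: "0 \<in> Sym d" by (rule form.subspace_0[OF S])
  have 1: "G \<in> Sym d \<and> B (u ^ d) G = bw d (u ^ d) G" if u: "u \<in> Sym 1" and G: "G \<in> Sym d" for u G
    using Sym_span_powers[THEN subsetD, OF G]
  proof (induction rule: form.span_induct_alt)
    case base
    show ?case using B(4)[of "u ^ d" 0 0] bw_bilinear(4)[of d "u ^ d" 0 0] zero Sym_power[OF u] by simp
  next
    case (step c x y)
    then show ?case
      using B(2,4) bw_bilinear pow bw_power Sym_power u form.subspace_add[OF S] form.subspace_scale[OF S]
      by auto
  qed
  have "F \<in> Sym d \<and> B F G = bw d F G"
    using Sym_span_powers[THEN subsetD, OF F]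
  proof (induction rule: form.span_induct_alt)
    case base
    show ?case using B(3)[of 0 G 0] bw_bilinear(3)[of d 0 0 G] zero G by simp
  next
    case (step c x y)
    then show ?case
      using B(1,3) bw_bilinear 1 G Sym_power form.subspace_add[OF S] form.subspace_scale[OF S]
      by auto
  qed
  then show ?thesis by simp
qed

end

theory Submission
  imports Defs
begin

text \<open>
  Writing \<open>H(u)\<close> for the value of a polynomial \<open>H\<close> at the coefficient vector of a linear form \<open>u\<close>,
  everything rests on the identity \<open>\<langle>u\<^sup>d, K\<rangle> = K\<^sub>d(u)\<close>, where \<open>K\<^sub>d\<close> is the part of \<open>K\<close> of degree \<open>d\<close>: pairing
  with a power of \<open>u\<close> only sees \<open>K\<close> on the line spanned by \<open>u\<close>. The restriction \<open>on_line u K\<close>, that is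
  \<open>K(tu) \<in> \<complex>[t]\<close>, records all these values at once and is multiplicative in \<open>K\<close>.

  Put \<open>\<gamma>\<^sub>1 = \<alpha> - \<mu>\<close>, \<open>\<gamma>\<^sub>i = \<beta>\<^sub>i\<close> and \<open>L\<^sub>1 = L\<close>, so that \<open>G = F - \<mu>L\<^sup>d = \<Sum>\<gamma>\<^sub>iL\<^sub>i\<^sup>d\<close>. Rank three forces
  \<open>\<beta>\<^sub>2, \<beta>\<^sub>3 \<noteq> 0\<close>, pairwise independent \<open>L\<^sub>i\<close> (\<open>rank_3_independent\<close>) and \<open>d \<ge> 2\<close>. The eigenvector condition
  is the linear relation \<open>\<Sum>\<gamma>\<^sub>i\<langle>L, L\<^sub>i\<rangle>\<^sup>d\<^sup>-\<^sup>1L\<^sub>i = 0\<close> (\<open>eigenvector_three_powers\<close>). If \<open>\<mu> = \<alpha>\<close> or \<open>L\<close> is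
  isotropic, its first term vanishes; independence of \<open>L\<^sub>2, L\<^sub>3\<close> then makes \<open>L\<close> orthogonal to both,
  so \<open>L = 0\<close>, a contradiction. In all other cases, every coefficient of the relation is nonzero.

  For the ideal, \<open>Ann G\<close> is the largest ideal on which \<open>\<langle>G, -\<rangle>\<close> vanishes (\<open>Ann_iff_bw\<close>). Testing
  \<open>H \<in> Ann G\<close> against multipliers vanishing on two of the three lines shows that the restrictions of
  \<open>H\<close> are divisible by \<open>t\<^sup>d\<^sup>-\<^sup>1\<close>, hence can be written \<open>g\<^sub>i\<close> times the restriction of \<open>L\<^sup>d\<^sup>-\<^sup>1\<close>.
  Multipliers of degree one and zero show that the \<open>g\<^sub>i\<close> have a common constant term and that their
  linear terms are subject to the same linear relation as the \<open>L\<^sub>i\<close>. Exactly these triples are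
  restrictions of a polynomial \<open>B\<close> (\<open>three_lines_interpolation\<close>). Now \<open>H - B L\<^sup>d\<^sup>-\<^sup>1\<close> vanishes on all
  three lines, so it is a multiple of the product of their equations (\<open>three_lines_dvd\<close>). The other
  inclusion follows from the same description of \<open>Ann G\<close>. For \<open>L\<^sup>d\<^sup>-\<^sup>1\<close> it is the relation once more.
\<close>

section \<open>Restriction to a line through the origin\<close>

text \<open>
  This is \<open>H(tu)\<close> as a polynomial in \<open>t\<close>; the coefficient of \<open>t\<^sup>k\<close> is the value at \<open>u\<close> of the part of
  \<open>H\<close> of degree \<open>k\<close>.
\<close>

definition on_line :: "complex poly poly \<Rightarrow> complex poly poly \<Rightarrow> complex poly" where
  "on_line u H = (\<Sum>j\<le>degree H. pcompose (coeff H j) [:0, coeff2 u 1 0:] * [:0, coeff2 u 0 1:] ^ j)"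

lemma poly_on_line:
  "poly (on_line u H) t = poly (poly H [:t * coeff2 u 0 1:]) (t * coeff2 u 1 0)"
  by (simp add: on_line_def poly_altdef[of H] poly_sum poly_pcompose)

text \<open>
  A complex polynomial is determined by its values, so these laws reduce to those of evaluation at
  the points \<open>tu\<close>.
\<close>

lemma on_line_add: "on_line u (G + H) = on_line u G + on_line u H"
  and on_line_diff: "on_line u (G - H) = on_line u G - on_line u H"
  and on_line_mult: "on_line u (G * H) = on_line u G * on_line u H"
  and on_line_power: "on_line u (G ^ n) = on_line u G ^ n"
  and on_line_cscale: "on_line u (cscale c G) = smult c (on_line u G)"
  and on_line_const: "on_line u [:[:c:]:] = [:c:]"
  and on_line_0: "on_line u 0 = 0"
  by (simp_all add: poly_on_line cscale_def fun_eq_iff flip: poly_eq_poly_eq_iff)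

lemma on_line_sum: "on_line u (sum f A) = (\<Sum>x\<in>A. on_line u (f x))"
  by (induction A rule: infinite_finite_induct) (simp_all add: on_line_add on_line_0)

lemma on_line_linear:
  assumes "M \<in> Sym 1"
  shows "on_line u M = monom (cpair M u) 1"
  by (subst Sym1_eq[OF assms])
    (simp add: poly_on_line poly_monom cpair_def algebra_simps fun_eq_iff flip: poly_eq_poly_eq_iff)

lemma on_line_linear_power:
  assumes "M \<in> Sym 1"
  shows "on_line u (M ^ n) = monom (cpair M u ^ n) n"
  by (simp add: on_line_power on_line_linear[OF assms] monom_power)

abbreviation mono2 :: "nat \<Rightarrow> nat \<Rightarrow> complex poly poly" where
  "mono2 i j \<equiv> monom (monom 1 i) j"

lemma on_line_mono2:
  "on_line u (mono2 i j) = monom (coeff2 u 1 0 ^ i * coeff2 u 0 1 ^ j) (i + j)"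
  by (simp add: poly_on_line poly_monom power_mult_distrib power_add mult_ac
      fun_eq_iff flip: poly_eq_poly_eq_iff)

lemma mono2_expansion:
  "H = (\<Sum>j\<le>degree H. \<Sum>i\<le>degree (coeff H j). cscale (coeff2 H i j) (mono2 i j))"
proof -
  have "(\<Sum>i\<le>degree (coeff H j). cscale (coeff2 H i j) (mono2 i j)) = monom (coeff H j) j" for j
  proof -
    have "(\<Sum>i\<le>degree (coeff H j). cscale (coeff2 H i j) (mono2 i j)) =
        monom (\<Sum>i\<le>degree (coeff H j). monom (coeff2 H i j) i) j"
      by (simp add: cscale_def smult_monom monom_sum)
    then show ?thesis by (simp add: coeff2_def poly_as_sum_of_monoms)
  qed
  then show ?thesis by (simp add: poly_as_sum_of_monoms)
qed

section \<open>The Bombieri-Weyl product and the apolar ideal\<close>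

lemma bw_sum_right: "bw d F (sum f A) = (\<Sum>x\<in>A. bw d F (f x))"
proof -
  have "bw d F 0 = 0" by (simp add: bw_def coeff2_simps)
  then show ?thesis
    by (induction A rule: infinite_finite_induct) (simp_all add: bw_bilinear)
qed

lemma bw_expansion:
  "bw d F H = (\<Sum>j\<le>degree H. \<Sum>i\<le>degree (coeff H j). coeff2 H i j * bw d F (mono2 i j))"
  by (subst mono2_expansion[of H]) (simp add: bw_sum_right bw_bilinear)

lemma bw_mono2:
  "bw d F (mono2 p q) = (if p + q = d then coeff2 F p q / of_nat (d choose p) else 0)"
proof -
  have "bw d F (mono2 p q) =
      (\<Sum>i\<le>d. if i = p then (if q = d - p then coeff2 F p q / of_nat (d choose p) else 0) else 0)"
    unfolding bw_def by (intro sum.cong refl) (auto simp: coeff2_def)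
  also have "\<dots> = (if p + q = d then coeff2 F p q / of_nat (d choose p) else 0)"
    by (subst sum.delta) auto
  finally show ?thesis .
qed

text \<open>
  The binomial weights of the product are those of the coefficients of \<open>u\<^sup>d\<close>, so they cancel and only
  evaluation at \<open>u\<close> remains. The second argument is arbitrary: its parts of degree other than \<open>d\<close>
  contribute nothing on either side.
\<close>

lemma bw_power_left:
  assumes "u \<in> Sym 1"
  shows "bw d (u ^ d) H = coeff (on_line u H) d"
proof -
  have "coeff2 (u ^ d) i j =
      (if i + j = d then of_nat (d choose i) * coeff2 u 1 0 ^ i * coeff2 u 0 1 ^ j else 0)" for i j
    using coeff2_linear_power[of "coeff2 u 0 1" "coeff2 u 1 0" d i j] Sym1_eq[OF assms] by simp
  then have "bw d (u ^ d) (mono2 i j) = coeff (on_line u (mono2 i j)) d" for i j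
    by (auto simp: bw_mono2 on_line_mono2)
  then show ?thesis
    by (subst (2) mono2_expansion[of H])
      (simp add: bw_expansion[of d _ H] on_line_sum on_line_cscale coeff_sum)
qed

lemma coeff2_D0_funpow:
  "fact m * coeff2 ((D0 ^^ i) F) m n = fact (m + i) * coeff2 F (m + i) n"
proof (induction i arbitrary: m)
  case (Suc i)
  have "coeff2 (D0 G) m n = of_nat (Suc m) * coeff2 G (Suc m) n" for G
    by (simp add: D0_def coeff2_def coeff_map_poly coeff_pderiv)
  then have "fact m * coeff2 ((D0 ^^ Suc i) F) m n = fact (Suc m) * coeff2 ((D0 ^^ i) F) (Suc m) n"
    by (simp add: algebra_simps)
  then show ?case by (simp only: Suc.IH) simp
qed simp

lemma coeff2_D1_funpow:
  "fact n * coeff2 ((D1 ^^ j) F) m n = fact (n + j) * coeff2 F m (n + j)"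
proof (induction j arbitrary: n)
  case (Suc j)
  have "coeff2 (D1 G) m n = of_nat (Suc n) * coeff2 G m (Suc n)" for G
    by (simp add: D1_def coeff2_def coeff_pderiv of_nat_poly del: of_nat_Suc)
  then have "fact n * coeff2 ((D1 ^^ Suc j) F) m n = fact (Suc n) * coeff2 ((D1 ^^ j) F) m (Suc n)"
    by (simp add: algebra_simps)
  then show ?case by (simp only: Suc.IH) simp
qed simp

text \<open>
  Up to factorials, multiplication is adjoint to differentiation: the coefficients of \<open>H \<circ> F\<close> are the
  products of \<open>F\<close> with the monomial multiples of \<open>H\<close>. By linearity in \<open>H\<close> it suffices to compare
  both sides for monomials.
\<close>

lemma coeff2_apolar:
  assumes F: "F \<in> Sym d"
  shows "fact m * fact n * coeff2 (apolar H F) m n = fact d * bw d F (mono2 m n * H)"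
proof -
  have mono: "fact m * fact n * coeff2 ((D0 ^^ i) ((D1 ^^ j) F)) m n =
      fact d * bw d F (mono2 m n * mono2 i j)" for i j
  proof -
    have "fact m * fact n * coeff2 ((D0 ^^ i) ((D1 ^^ j) F)) m n =
        fact (m + i) * (fact n * coeff2 ((D1 ^^ j) F) (m + i) n)"
      using coeff2_D0_funpow[of m i "(D1 ^^ j) F" n] by (simp add: mult_ac)
    also have "\<dots> = fact (m + i) * fact (n + j) * coeff2 F (m + i) (n + j)"
      by (simp add: coeff2_D1_funpow mult.assoc)
    also have "\<dots> = fact d * bw d F (mono2 (m + i) (n + j))"
    proof (cases "m + i + (n + j) = d")
      case True
      then have "(of_nat (d choose (m + i)) :: complex) = fact d / (fact (m + i) * fact (n + j))"
        by (subst binomial_fact) auto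
      with True show ?thesis by (simp add: bw_mono2)
    next
      case False
      with F have "coeff2 F (m + i) (n + j) = 0" by (auto simp: Sym_def)
      with False show ?thesis by (simp add: bw_mono2)
    qed
    finally show ?thesis by (simp add: mult_monom)
  qed
  have "fact d * bw d F (mono2 m n * H) = fact d * bw d F (mono2 m n *
      (\<Sum>j\<le>degree H. \<Sum>i\<le>degree (coeff H j). cscale (coeff2 H i j) (mono2 i j)))"
    by (simp flip: mono2_expansion)
  also have "\<dots> = (\<Sum>j\<le>degree H. \<Sum>i\<le>degree (coeff H j).
      coeff2 H i j * (fact d * bw d F (mono2 m n * mono2 i j)))"
    by (simp add: sum_distrib_left cscale_def bw_sum_right bw_bilinear(4)[unfolded cscale_def]
        mult.left_commute del: mult_monom)
  also have "\<dots> = fact m * fact n * coeff2 (apolar H F) m n"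
    unfolding mono[symmetric] apolar_def coeff2_sum coeff2_simps
    by (simp add: sum_distrib_left mult.left_commute)
  finally show ?thesis by simp
qed

text \<open>
  Expanding the multiplier \<open>C\<close> into monomials, all these products vanish if and only if all
  coefficients of \<open>H \<circ> F\<close> do.
\<close>

lemma Ann_iff_bw:
  assumes "F \<in> Sym d"
  shows "H \<in> Ann F \<longleftrightarrow> (\<forall>C. bw d F (C * H) = 0)"
proof
  assume "H \<in> Ann F"
  then have mono: "bw d F (mono2 i j * H) = 0" for i j
    using coeff2_apolar[OF assms, of i j H] by (simp add: Ann_def coeff2_simps)
  show "\<forall>C. bw d F (C * H) = 0"
  proof
    fix C
    have "bw d F (C * H) = bw d F
        ((\<Sum>j\<le>degree C. \<Sum>i\<le>degree (coeff C j). cscale (coeff2 C i j) (mono2 i j)) * H)"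
      by (simp flip: mono2_expansion)
    also have "\<dots> = 0"
      by (simp add: sum_distrib_right cscale_def bw_sum_right bw_bilinear(4)[unfolded cscale_def] mono)
    finally show "bw d F (C * H) = 0" .
  qed
next
  assume "\<forall>C. bw d F (C * H) = 0"
  then have "coeff2 (apolar H F) m n = 0" for m n
    using coeff2_apolar[OF assms, of m n H] by simp
  then show "H \<in> Ann F" by (simp add: Ann_def poly2_eqI coeff2_simps)
qed

section \<open>Linear forms and orthogonality\<close>

definition perp :: "complex poly poly \<Rightarrow> complex poly poly" where
  "perp u = monom [:coeff2 u 1 0:] 1 + [:monom (- coeff2 u 0 1) 1:]"

lemma coeff2_perp: "coeff2 (perp u) 1 0 = - coeff2 u 0 1" "coeff2 (perp u) 0 1 = coeff2 u 1 0"
  by (simp_all add: perp_def coeff2_def)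

lemma perp_in_Sym1: "perp u \<in> Sym 1"
  unfolding perp_def by (rule Sym1_linear)

lemma Sym1_eqI:
  assumes "u \<in> Sym 1" "v \<in> Sym 1"
    and "coeff2 u 1 0 = coeff2 v 1 0" "coeff2 u 0 1 = coeff2 v 0 1"
  shows "u = v"
  using assms Sym1_eq by metis

lemma Sym1_cscale: "u \<in> Sym 1 \<Longrightarrow> cscale c u \<in> Sym 1"
  by (rule form.subspace_scale[OF Sym_subspace])

lemma Sym1_nonzero_iff:
  "u \<in> Sym 1 \<Longrightarrow> u \<noteq> 0 \<longleftrightarrow> coeff2 u 1 0 \<noteq> 0 \<or> coeff2 u 0 1 \<noteq> 0"
  using Sym1_eqI[of u 0] form.subspace_0[OF Sym_subspace] by (auto simp: coeff2_simps)

lemma is_perp_perp: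
  assumes "u \<in> Sym 1" "u \<noteq> 0"
  shows "is_perp (perp u) u"
  using assms Sym1_nonzero_iff[OF assms(1)] Sym1_nonzero_iff[OF perp_in_Sym1, of u] perp_in_Sym1[of u]
  by (auto simp: is_perp_def cpair_def coeff2_perp[simplified])

text \<open>
  The pairing is nondegenerate on a plane, so the orthogonal complement of a nonzero vector is a line.
\<close>

lemma orthogonal_eq_scaled_perp:
  assumes P: "P \<in> Sym 1" "P \<noteq> 0" and u: "u \<in> Sym 1" "cpair P u = 0"
  shows "\<exists>c. u = cscale c (perp P)"
proof -
  have "\<exists>c. c * coeff2 P 0 1 = - coeff2 u 1 0 \<and> c * coeff2 P 1 0 = coeff2 u 0 1"
  proof (cases "coeff2 P 1 0 = 0")
    case True
    then show ?thesis using P u Sym1_nonzero_iff[OF P(1)]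
      by (intro exI[of _ "- coeff2 u 1 0 / coeff2 P 0 1"]) (auto simp: cpair_def)
  next
    case False
    then show ?thesis using u
      by (intro exI[of _ "coeff2 u 0 1 / coeff2 P 1 0"])
        (auto simp: cpair_def field_simps eq_neg_iff_add_eq_0)
  qed
  then obtain c where "c * coeff2 P 0 1 = - coeff2 u 1 0" "c * coeff2 P 1 0 = coeff2 u 0 1"
    by blast
  then have "u = cscale c (perp P)"
    using u by (intro Sym1_eqI Sym1_cscale perp_in_Sym1) (simp_all add: coeff2_simps coeff2_perp[simplified])
  then show ?thesis ..
qed

lemma poly_poly_at_const: "poly (poly (H :: complex poly poly) q) s = poly (poly H [:poly q s:]) s"
  by (simp add: poly_altdef[of H] poly_sum)

lemma cscale_dvd:
  assumes "k \<noteq> 0" "p dvd q"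
  shows "cscale k p dvd q"
proof -
  from assms(2) obtain r where "q = p * r" by (elim dvdE)
  then have "q = cscale k p * cscale (inverse k) r"
    using assms(1) by (simp add: cscale_def one_pCons[symmetric])
  then show ?thesis by (rule dvdI)
qed

text \<open>
  The factor theorem. If \<open>u\<close> is not on the axis \<open>x\<^sub>0 = 0\<close>, it is the usual one over \<open>\<complex>[x\<^sub>0]\<close>, with
  \<open>x\<^sub>1 = (b/a)x\<^sub>0\<close> as root; on that axis it says that \<open>x\<^sub>0\<close> divides every coefficient of \<open>H\<close>.
\<close>

lemma perp_dvd:
  assumes u: "u \<in> Sym 1" "u \<noteq> 0" and P: "is_perp P u" and H: "on_line u H = 0"
  shows "P dvd H"
proof -
  define a b where "a = coeff2 u 1 0" and "b = coeff2 u 0 1"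
  have vanish: "poly (poly H [:t * b:]) (t * a) = 0" for t
    using poly_on_line[of u H t] H by (simp add: a_def b_def)
  obtain k where k: "P = cscale k (perp u)"
    using orthogonal_eq_scaled_perp[OF u, of P] P by (auto simp: is_perp_def cpair_def mult.commute)
  with P have "k \<noteq> 0" by (auto simp: is_perp_def)
  have "perp u dvd H"
  proof (cases "a = 0")
    case False
    have "poly (poly H [:0, b / a:]) s = 0" for s
      using vanish[of "s / a"] False by (subst poly_poly_at_const) simp
    then have "poly H [:0, b / a:] = 0"
      by (simp add: fun_eq_iff flip: poly_eq_poly_eq_iff)
    then have "[:- [:0, b / a:], 1:] dvd H" by (simp add: poly_eq_0_iff_dvd)
    moreover have "perp u = cscale a [:- [:0, b / a:], 1:]"
      using False by (simp add: cscale_def perp_def a_def b_def monom_altdef)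
    ultimately show ?thesis using False by (simp add: cscale_dvd)
  next
    case True
    with u have "b \<noteq> 0" using Sym1_nonzero_iff[OF u(1)] by (auto simp: a_def b_def)
    have "coeff (coeff H k) 0 = 0" for k
    proof (cases "k \<le> degree H")
      case k: True
      have pow: "[:0, b:] ^ j = monom (b ^ j) j" for j
        using monom_power[of b 1 j] by (simp add: monom_altdef)
      have "coeff (on_line u H) k = (\<Sum>j\<le>degree H. if j = k then coeff (coeff H k) 0 * b ^ k else 0)"
        unfolding on_line_def coeff_sum using True
        by (intro sum.cong refl) (auto simp: pow pcompose_0' coeff_monom_mult mult.commute simp flip: One_nat_def a_def b_def)
      then show ?thesis using k H \<open>b \<noteq> 0\<close> by simp
    qed (simp add: coeff_eq_0)
    then have "[:[:0, 1:]:] dvd H"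
      by (simp add: const_poly_dvd_iff flip: dvd_iff_poly_eq_0[of 0, simplified] poly_0_coeff_0)
    moreover have "perp u = cscale (- b) [:[:0, 1:]:]"
      using True by (simp add: cscale_def perp_def a_def b_def monom_altdef)
    ultimately show ?thesis using \<open>b \<noteq> 0\<close> by (simp add: cscale_dvd)
  qed
  then show ?thesis using k \<open>k \<noteq> 0\<close> by (simp add: cscale_dvd)
qed

section \<open>Consequences of Waring rank three\<close>

text \<open>
  Coefficients can be absorbed into the linear forms because complex numbers have \<open>d\<close>-th roots.
  Forms or coefficients may be zero, so the same bound also covers sums of fewer powers.
\<close>

lemma waring_rank_le_2:
  assumes d: "d \<ge> 1" and uv: "u \<in> Sym 1" "v \<in> Sym 1"
    and F: "F = cscale a (u ^ d) + cscale b (v ^ d)"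
  shows "waring_rank d F \<le> 2"
proof -
  have root: "\<exists>z. z ^ d = c" for c :: complex
  proof (cases "c = 0")
    case False
    then have "card {z. z ^ d = c} = d" using d by (intro card_nth_roots) auto
    then have "{z. z ^ d = c} \<noteq> {}" using d by (metis card.empty not_one_le_zero)
    then show ?thesis by blast
  qed (use d in auto)
  obtain x y where xy: "x ^ d = a" "y ^ d = b" using root by metis
  define M where "M i = (if i = 1 then cscale x u else cscale y v)" for i :: nat
  have "F = (\<Sum>i=1..2. M i ^ d)"
    by (simp add: F M_def cscale_def smult_power poly_const_pow xy numeral_2_eq_2)
  moreover have "\<forall>i\<in>{1..2}. M i \<in> Sym 1" using Sym1_cscale[OF uv(1)] Sym1_cscale[OF uv(2)] by (simp add: M_def)
  ultimately show ?thesis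
    unfolding waring_rank_def by (intro Least_le) blast
qed

text \<open>
  Otherwise \<open>u\<close> and \<open>v\<close> lie on one line and their powers merge into one, leaving two summands.
\<close>

lemma rank_3_independent:
  assumes d: "d \<ge> 1" and r: "waring_rank d F = 3"
    and uvw: "u \<in> Sym 1" "v \<in> Sym 1" "w \<in> Sym 1"
    and F: "F = cscale a (u ^ d) + cscale b (v ^ d) + cscale c (w ^ d)"
    and P: "is_perp P u"
  shows "cpair P v \<noteq> 0"
proof
  assume "cpair P v = 0"
  then obtain x y where "u = cscale x (perp P)" "v = cscale y (perp P)"
    using orthogonal_eq_scaled_perp uvw P by (metis is_perp_def)
  then have "F = cscale (a * x ^ d + b * y ^ d) (perp P ^ d) + cscale c (w ^ d)"
    unfolding F by (simp add: cscale_def smult_power poly_const_pow mult.commute flip: smult_add_left)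
  then show False using waring_rank_le_2[OF d perp_in_Sym1 uvw(3)] r by fastforce
qed

section \<open>Three concurrent lines\<close>

text \<open>
  A multiple of \<open>M\<close> restricts to \<open>t\<close>, so any polynomial in \<open>t\<close> can be reached by Horner's scheme.
\<close>

lemma on_line_surj:
  assumes "M \<in> Sym 1" "cpair M u \<noteq> 0"
  shows "\<exists>Q. on_line u Q = p"
proof (induction p)
  case 0
  show ?case using on_line_0 by blast
next
  case (pCons c p)
  then obtain Q where "on_line u Q = p" by blast
  then have "on_line u ([:[:c:]:] + cscale (inverse (cpair M u)) M * Q) = pCons c p"
    using assms(2)
    by (simp add: on_line_add on_line_mult on_line_cscale on_line_const
        on_line_linear[OF assms(1), simplified] monom_altdef)
  then show ?case by blast
qed

lemma poly_split_low:
  "(p :: complex poly) = [:coeff p 0:] + monom (coeff p 1) 1 + monom 1 2 * poly_shift 2 p"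
  by (rule poly_eqI)
    (auto simp: coeff_monom_mult coeff_poly_shift coeff_pCons numeral_2_eq_2 Suc_diff_Suc split: nat.splits)

lemma cpair_simps:
  "cpair (u + v) w = cpair u w + cpair v w"
  "cpair (cscale c u) w = c * cpair u w"
  by (simp_all add: cpair_def coeff2_simps algebra_simps)

text \<open>
  The triples of restrictions to three distinct lines through the origin: the constant terms agree
  at the common point, and the linear terms come from one linear form, hence satisfy the relation
  between the three directions. These are the only constraints, since a product of two of the
  \<open>P\<close>'s restricts to a multiple of \<open>t\<^sup>2\<close> on one line and to zero on the other two, so that terms of
  degree at least two can be prescribed independently.
\<close>

lemma three_lines_interpolation:
  assumes P: "P \<in> Sym 1" "P2 \<in> Sym 1" "P3 \<in> Sym 1"
    and van: "cpair P L = 0" "cpair P2 L2 = 0" "cpair P3 L3 = 0"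
    and nv: "cpair P L2 \<noteq> 0" "cpair P L3 \<noteq> 0" "cpair P2 L \<noteq> 0" "cpair P2 L3 \<noteq> 0"
      "cpair P3 L \<noteq> 0" "cpair P3 L2 \<noteq> 0"
    and rel: "\<And>M. M \<in> Sym 1 \<Longrightarrow> r * cpair M L + r2 * cpair M L2 + r3 * cpair M L3 = 0"
    and r3: "r3 \<noteq> 0"
    and g0: "coeff g 0 = coeff g2 0" "coeff g 0 = coeff g3 0"
    and g1: "r * coeff g 1 + r2 * coeff g2 1 + r3 * coeff g3 1 = 0"
  shows "\<exists>B. on_line L B = g \<and> on_line L2 B = g2 \<and> on_line L3 B = g3"
proof -
  \<comment> \<open>The linear part is determined by its values on the first two directions; the relation gives the third.\<close>
  define M where "M = cscale (coeff g 1 / cpair P2 L) P2 + cscale (coeff g2 1 / cpair P L2) P"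
  have M: "M \<in> Sym 1"
    unfolding M_def using P by (intro form.subspace_add[OF Sym_subspace] Sym1_cscale)
  have MLs: "cpair M L = coeff g 1" "cpair M L2 = coeff g2 1"
    using van nv by (simp_all add: M_def cpair_simps)
  moreover have "cpair M L3 = coeff g3 1"
  proof -
    have "r3 * cpair M L3 = r3 * coeff g3 1"
      using rel[OF M] g1 unfolding MLs by (metis add_left_cancel)
    then show ?thesis using r3 by simp
  qed
  moreover obtain Q where "on_line L Q = smult (1 / (cpair P2 L * cpair P3 L)) (poly_shift 2 g)"
    using on_line_surj P(2) nv(3) by blast
  moreover obtain Q2 where "on_line L2 Q2 = smult (1 / (cpair P L2 * cpair P3 L2)) (poly_shift 2 g2)"
    using on_line_surj P(1) nv(1) by blast
  moreover obtain Q3 where "on_line L3 Q3 = smult (1 / (cpair P L3 * cpair P2 L3)) (poly_shift 2 g3)"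
    using on_line_surj P(1) nv(2) by blast
  ultimately have "on_line L B = g \<and> on_line L2 B = g2 \<and> on_line L3 B = g3"
    if "B = [:[:coeff g 0:]:] + M + P2 * P3 * Q + P * P3 * Q2 + P * P2 * Q3" for B
    unfolding that using poly_split_low[of g] poly_split_low[of g2] poly_split_low[of g3] nv van g0
    by (simp add: on_line_add on_line_mult on_line_const on_line_linear P M mult_monom
        smult_monom numeral_2_eq_2 del: One_nat_def flip: mult_smult_left)
  then show ?thesis by blast
qed

text \<open>
  The factors can be split off one after the other, because \<open>\<complex>[t]\<close> is a domain and the equation of one
  line does not vanish on another.
\<close>

lemma three_lines_dvd:
  assumes L: "L \<in> Sym 1" "L2 \<in> Sym 1" "L3 \<in> Sym 1" "L \<noteq> 0" "L2 \<noteq> 0" "L3 \<noteq> 0"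
    and P: "is_perp P L" "is_perp P2 L2" "is_perp P3 L3"
    and nv: "cpair P L2 \<noteq> 0" "cpair P L3 \<noteq> 0" "cpair P2 L3 \<noteq> 0"
    and H: "on_line L H = 0" "on_line L2 H = 0" "on_line L3 H = 0"
  shows "P * P2 * P3 dvd H"
proof -
  have PS: "P \<in> Sym 1" "P2 \<in> Sym 1" using P by (auto simp: is_perp_def)
  obtain H1 where H1: "H = P * H1"
    using perp_dvd[OF L(1,4) P(1) H(1)] by (elim dvdE)
  have "on_line L2 H1 = 0" "on_line L3 H1 = 0"
    using H nv PS by (simp_all add: H1 on_line_mult on_line_linear del: One_nat_def)
  then obtain H2 where H2: "H1 = P2 * H2"
    using perp_dvd[OF L(2,5) P(2)] by (meson dvdE)
  have "on_line L3 H2 = 0"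
    using \<open>on_line L3 H1 = 0\<close> nv PS by (simp add: H2 on_line_mult on_line_linear del: One_nat_def)
  then have "P3 dvd H2" by (rule perp_dvd[OF L(3,6) P(3)])
  then show ?thesis unfolding H1 H2 mult.assoc by (intro mult_dvd_mono dvd_refl)
qed

section \<open>The apolar ideal of a sum of three powers\<close>

text \<open>
  The coefficient of \<open>t\<close> in \<open>C(tu)\<close> is the value at \<open>u\<close> of the degree one part of \<open>C\<close>, one linear form
  for all lines at once.
\<close>

lemma linear_part:
  "\<exists>M\<in>Sym 1. \<forall>u\<in>Sym 1. coeff (on_line u C) 1 = cpair M u"
proof (intro bexI ballI)
  let ?M = "monom [:coeff2 C 0 1:] 1 + [:monom (coeff2 C 1 0) 1:]"
  show "?M \<in> Sym 1" by (rule Sym1_linear)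
  fix u
  assume "u \<in> Sym 1"
  have "coeff2 ?M 1 0 = coeff2 C 1 0" "coeff2 ?M 0 1 = coeff2 C 0 1"
    by (simp_all add: coeff2_def)
  then show "coeff (on_line u C) 1 = cpair ?M u"
    using bw_power_left[OF \<open>u \<in> Sym 1\<close>, of 1 C] by (simp add: bw_def cpair_def algebra_simps)
qed

text \<open>
  With \<open>C = Q\<^sup>d\<^sup>-\<^sup>k\<^sup>-\<^sup>1R\<close>, a form of degree \<open>d - k \<ge> 2\<close> that vanishes at \<open>v\<close> and \<open>w\<close> but not at \<open>u\<close>, a single
  term survives. Both factors must occur, which is why the argument stops at \<open>k = d - 2\<close>.
\<close>

lemma low_coeffs_vanish:
  assumes van: "\<And>C. a * coeff (on_line u (C * H)) d + b * coeff (on_line v (C * H)) d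
      + c * coeff (on_line w (C * H)) d = 0"
    and Q: "Q \<in> Sym 1" "cpair Q v = 0" "cpair Q u \<noteq> 0"
    and R: "R \<in> Sym 1" "cpair R w = 0" "cpair R u \<noteq> 0"
    and a: "a \<noteq> 0" and k: "k + 2 \<le> d"
  shows "coeff (on_line u H) k = 0"
proof -
  define m where "m = d - k - 2"
  have d: "d = k + (Suc m + 1)" using k by (simp add: m_def)
  have "coeff (on_line x (Q ^ Suc m * R * H)) d = cpair Q x ^ Suc m * cpair R x * coeff (on_line x H) k" for x
    unfolding on_line_mult on_line_linear_power[OF Q(1)] on_line_linear[OF R(1)] mult_monom coeff_monom_mult
    by (simp add: d)
  with van[of "Q ^ Suc m * R"] have "a * (cpair Q u ^ Suc m * cpair R u * coeff (on_line u H) k) = 0"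
    using Q(2) R(2) by simp
  then show ?thesis using a Q(3) R(3) by simp
qed

text \<open>
  The relation \<open>rel\<close> says that \<open>K\<^sup>d\<^sup>-\<^sup>1\<close> annihilates \<open>G\<close>. Since pairwise independent vectors in the plane
  satisfy only one linear relation up to scalars, every element of \<open>Ann G\<close> vanishes on the three
  lines after subtraction of a multiple of \<open>K\<^sup>d\<^sup>-\<^sup>1\<close>.
\<close>

lemma Ann_three_powers:
  assumes d: "d \<ge> 2"
    and G: "G = cscale a (L ^ d) + cscale a2 (L2 ^ d) + cscale a3 (L3 ^ d)"
    and L: "L \<in> Sym 1" "L2 \<in> Sym 1" "L3 \<in> Sym 1"
    and a: "a \<noteq> 0" "a2 \<noteq> 0" "a3 \<noteq> 0"
    and P: "is_perp P L" "is_perp P2 L2" "is_perp P3 L3"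
    and nv: "cpair P L2 \<noteq> 0" "cpair P L3 \<noteq> 0" "cpair P2 L \<noteq> 0" "cpair P2 L3 \<noteq> 0"
      "cpair P3 L \<noteq> 0" "cpair P3 L2 \<noteq> 0"
    and K: "K \<in> Sym 1" "cpair K L \<noteq> 0"
    and rel: "\<And>M. M \<in> Sym 1 \<Longrightarrow> a * cpair K L ^ (d - 1) * cpair M L
      + a2 * cpair K L2 ^ (d - 1) * cpair M L2 + a3 * cpair K L3 ^ (d - 1) * cpair M L3 = 0"
  shows "Ann G = ideal.span {P * P2 * P3, K ^ (d - 1)}"
proof -
  have PS: "P \<in> Sym 1" "P2 \<in> Sym 1" "P3 \<in> Sym 1"
    and van: "cpair P L = 0" "cpair P2 L2 = 0" "cpair P3 L3 = 0"
    using P by (auto simp: is_perp_def)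
  define n where "n = d - 1"
  then have dn: "d = Suc n" "n \<ge> 1" using d by auto
  define e e2 e3 where "e = cpair K L ^ n" and "e2 = cpair K L2 ^ n" and "e3 = cpair K L3 ^ n"
  have rel: "a * e * cpair M L + a2 * e2 * cpair M L2 + a3 * e3 * cpair M L3 = 0"
    if "M \<in> Sym 1" for M
    using rel[OF that] by (simp add: e_def e2_def e3_def n_def)
  have e: "e \<noteq> 0" using K by (simp add: e_def)
  have e2: "e2 \<noteq> 0" using rel[OF PS(3)] e a nv van by auto
  have e3: "e3 \<noteq> 0" using rel[OF PS(2)] e a nv van by auto
  have Kn: "on_line L (K ^ n) = monom e n" "on_line L2 (K ^ n) = monom e2 n"
      "on_line L3 (K ^ n) = monom e3 n"
    by (simp_all only: on_line_linear_power[OF K(1)] e_def e2_def e3_def)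
  have "G \<in> Sym d"
    unfolding G
    by (intro form.subspace_add[OF Sym_subspace] form.subspace_scale[OF Sym_subspace] Sym_power L)
  moreover have "bw d G H = a * coeff (on_line L H) d + a2 * coeff (on_line L2 H) d
      + a3 * coeff (on_line L3 H) d" for H
    by (simp add: G bw_bilinear bw_power_left[OF L(1)] bw_power_left[OF L(2)] bw_power_left[OF L(3)])
  ultimately have Ann: "H \<in> Ann G \<longleftrightarrow> (\<forall>C. a * coeff (on_line L (C * H)) d
      + a2 * coeff (on_line L2 (C * H)) d + a3 * coeff (on_line L3 (C * H)) d = 0)" for H
    using Ann_iff_bw by simp
  have span: "H \<in> ideal.span {P * P2 * P3, K ^ n} \<longleftrightarrow>
      (\<exists>A B. H = A * (P * P2 * P3) + B * K ^ n)" for H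
    unfolding ideal.span_breakdown_eq ideal.span_singleton image_iff diff_eq_eq
    by (simp add: add.commute)
  have "Ann G = ideal.span {P * P2 * P3, K ^ n}"
  proof (intro set_eqI iffI)
    fix H
    assume "H \<in> ideal.span {P * P2 * P3, K ^ n}"
    then obtain A B where H: "H = A * (P * P2 * P3) + B * K ^ n"
      using span by blast
    show "H \<in> Ann G"
      unfolding Ann
    proof
      fix C
      obtain M where M: "M \<in> Sym 1"
        and C1: "\<And>u. u \<in> Sym 1 \<Longrightarrow> coeff (on_line u (C * B)) 1 = cpair M u"
        using linear_part by blast
      have CH: "on_line u (C * H) = monom c n * on_line u (C * B)"
        if "on_line u (P * P2 * P3) = 0" "on_line u (K ^ n) = monom c n" for u c
        using that by (simp only: H on_line_mult[of u C] on_line_mult[of u A] on_line_mult[of u B]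
            on_line_add mult_zero_left mult_zero_right add_0_left mult_ac)
      have "on_line u (P * P2 * P3) = 0" if "cpair P u * cpair P2 u * cpair P3 u = 0" for u
        unfolding on_line_mult on_line_linear[OF PS(1)] on_line_linear[OF PS(2)]
          on_line_linear[OF PS(3)] mult_monom that by simp
      then have "coeff (on_line L (C * H)) d = e * cpair M L"
          "coeff (on_line L2 (C * H)) d = e2 * cpair M L2"
          "coeff (on_line L3 (C * H)) d = e3 * cpair M L3"
        using CH[OF _ Kn(1)] CH[OF _ Kn(2)] CH[OF _ Kn(3)] C1 L van
        by (simp_all add: dn(1) coeff_monom_mult)
      then show "a * coeff (on_line L (C * H)) d + a2 * coeff (on_line L2 (C * H)) d
          + a3 * coeff (on_line L3 (C * H)) d = 0"
        using rel[OF M] by (simp add: mult.assoc)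
    qed
  next
    fix H
    assume "H \<in> Ann G"
    then have pair: "a * coeff (on_line L (C * H)) d
      + a2 * coeff (on_line L2 (C * H)) d + a3 * coeff (on_line L3 (C * H)) d = 0" for C
      using Ann by blast
    \<comment> \<open>The restrictions of \<open>H\<close> are multiples of those of \<open>K\<^sup>n\<close>.\<close>
    have low: "coeff (on_line L H) k = 0" "coeff (on_line L2 H) k = 0" "coeff (on_line L3 H) k = 0"
      if "k < n" for k
    proof -
      have k: "k + 2 \<le> d" using that dn by simp
      show "coeff (on_line L H) k = 0"
        by (rule low_coeffs_vanish[OF pair PS(2) van(2) nv(3) PS(3) van(3) nv(5) a(1) k])
      have "a2 * coeff (on_line L2 (C * H)) d + a * coeff (on_line L (C * H)) d
          + a3 * coeff (on_line L3 (C * H)) d = 0" for C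
        using pair[of C] by (simp add: add_ac)
      then show "coeff (on_line L2 H) k = 0"
        by (rule low_coeffs_vanish[OF _ PS(1) van(1) nv(1) PS(3) van(3) nv(6) a(2) k])
      have "a3 * coeff (on_line L3 (C * H)) d + a * coeff (on_line L (C * H)) d
          + a2 * coeff (on_line L2 (C * H)) d = 0" for C
        using pair[of C] by (simp add: add_ac)
      then show "coeff (on_line L3 H) k = 0"
        by (rule low_coeffs_vanish[OF _ PS(1) van(1) nv(2) PS(2) van(2) nv(4) a(3) k])
    qed
    have "\<exists>g. p = monom c n * g" if "\<And>k. k < n \<Longrightarrow> coeff p k = 0" "c \<noteq> 0" for p and c :: complex
    proof -
      have "monom 1 n dvd p" using that by (simp add: monom_1_dvd_iff')
      then obtain r where "p = monom 1 n * r" by (elim dvdE)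
      then have "p = monom c n * smult (inverse c) r" using that by (simp add: smult_monom flip: mult_smult_left)
      then show ?thesis by blast
    qed
    then obtain g g2 g3 where g: "on_line L H = monom e n * g" "on_line L2 H = monom e2 n * g2"
        "on_line L3 H = monom e3 n * g3"
      using low e e2 e3 by metis
    \<comment> \<open>Linear multipliers give a relation between the lines with coefficients \<open>a\<^sub>ie\<^sub>ig\<^sub>i(0)\<close>; comparing it with
      \<open>rel\<close> shows that the \<open>g\<^sub>i(0)\<close> agree. The multiplier 1 gives the condition on the linear terms.\<close>
    have top0: "a * e * cpair M L * coeff g 0 + a2 * e2 * cpair M L2 * coeff g2 0
        + a3 * e3 * cpair M L3 * coeff g3 0 = 0" if "M \<in> Sym 1" for M
    proof -
      have "coeff (on_line x (M * H)) d = cpair M x * coeff (on_line x H) n" for x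
        unfolding on_line_mult on_line_linear[OF that] coeff_monom_mult by (simp add: dn(1))
      then show ?thesis
        using pair[of M] by (simp add: g coeff_monom_mult mult.assoc mult.left_commute)
    qed
    have g1: "a * e * coeff g 1 + a2 * e2 * coeff g2 1 + a3 * e3 * coeff g3 1 = 0"
      using pair[of 1] by (simp add: g dn coeff_monom_mult mult.assoc)
    have g0: "coeff g 0 = coeff g2 0" "coeff g 0 = coeff g3 0"
    proof -
      have "a * e * cpair P3 L = - (a2 * e2 * cpair P3 L2)"
        using rel[OF PS(3)] van by (simp add: eq_neg_iff_add_eq_0)
      then have "a2 * e2 * cpair P3 L2 * (coeff g2 0 - coeff g 0) = 0"
        using top0[OF PS(3)] van by (simp add: algebra_simps)
      then show "coeff g 0 = coeff g2 0" using a e2 nv by simp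
      have "a * e * cpair P2 L = - (a3 * e3 * cpair P2 L3)"
        using rel[OF PS(2)] van by (simp add: eq_neg_iff_add_eq_0)
      then have "a3 * e3 * cpair P2 L3 * (coeff g3 0 - coeff g 0) = 0"
        using top0[OF PS(2)] van by (simp add: algebra_simps)
      then show "coeff g 0 = coeff g3 0" using a e3 nv by simp
    qed
    obtain B where B: "on_line L B = g" "on_line L2 B = g2" "on_line L3 B = g3"
      using three_lines_interpolation[OF PS van nv rel _ g0 g1] a e3 by auto
    have "P * P2 * P3 dvd H - B * K ^ n"
    proof (rule three_lines_dvd[OF L _ _ _ P])
      show "L \<noteq> 0" "L2 \<noteq> 0" "L3 \<noteq> 0" using nv by (auto simp: cpair_def coeff2_simps)
    qed (simp_all add: nv on_line_diff on_line_mult B g Kn)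
    then obtain A where "H - B * K ^ n = P * P2 * P3 * A" by (elim dvdE)
    then have "H = A * (P * P2 * P3) + B * K ^ n"
      unfolding diff_eq_eq mult.commute[of A] .
    then show "H \<in> ideal.span {P * P2 * P3, K ^ n}" using span by blast
  qed
  then show ?thesis by (simp add: n_def)
qed

section \<open>Eigenvectors of rank three forms\<close>

text \<open>
  Orthogonality to all \<open>K\<^sup>d\<^sup>-\<^sup>1M\<close> is a linear relation between \<open>L, L2, L3, K\<close>, tested against each \<open>M\<close>.
\<close>

lemma eigenvector_three_powers:
  assumes d: "d \<ge> 2" and L: "L \<in> Sym 1" "L2 \<in> Sym 1" "L3 \<in> Sym 1"
    and eig: "is_eigenvector d (cscale a (L ^ d) + cscale b (L2 ^ d) + cscale c (L3 ^ d)) K \<mu>"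
    and M: "M \<in> Sym 1"
  shows "a * cpair K L ^ (d - 1) * cpair M L + b * cpair K L2 ^ (d - 1) * cpair M L2
      + c * cpair K L3 ^ (d - 1) * cpair M L3 = \<mu> * cpair K K ^ (d - 1) * cpair M K"
proof -
  have K: "K \<in> Sym 1" using eig by (simp add: is_eigenvector_def)
  have pw: "bw d (u ^ d) (K ^ (d - 1) * M) = cpair K u ^ (d - 1) * cpair M u" if "u \<in> Sym 1" for u
    using d unfolding bw_power_left[OF that] on_line_mult on_line_linear_power[OF K] on_line_linear[OF M]
    by (simp add: mult_monom)
  have diff: "bw d (X - Y) Z = bw d X Z - bw d Y Z" for X Y Z
    using bw_bilinear(1)[of d "X - Y" Y Z] by simp
  have "bw d (cscale a (L ^ d) + cscale b (L2 ^ d) + cscale c (L3 ^ d) - cscale \<mu> (K ^ d))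
      (K ^ (d - 1) * M) = 0"
    using eig M by (simp add: is_eigenvector_def)
  then show ?thesis
    by (simp add: diff bw_bilinear pw L K mult.assoc del: One_nat_def)
qed

theorem proposition3p7:
  fixes d :: nat and F L L2 L3 :: "complex poly poly" and \<alpha> \<beta>2 \<beta>3 \<mu> :: complex
  assumes "d \<ge> 1"
    and "F \<in> Sym d"
    and "waring_rank d F = 3"
    and "L \<in> Sym 1" and "L \<noteq> 0"
    and "proj L \<in> waring_locus d F \<inter> Eig d F"
    and "L2 \<in> Sym 1" and "L3 \<in> Sym 1"
    and "F = cscale \<alpha> (L ^ d) + cscale \<beta>2 (L2 ^ d) + cscale \<beta>3 (L3 ^ d)"
    and "is_eigenvector d F L \<mu>"
  shows "\<mu> \<noteq> \<alpha> \<and> \<not> isotropic L \<and>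
    (d \<ge> 4 \<longrightarrow> (\<forall>P P2 P3. is_perp P L \<and> is_perp P2 L2 \<and> is_perp P3 L3 \<longrightarrow>
       Ann (F - cscale \<mu> (L ^ d)) = ideal.span {P * P2 * P3, L ^ (d - 1)}))"
proof -
  note d1 = assms(1) and r = assms(3) and L = assms(4) assms(7,8) and F = assms(9)
  have F2: "F = cscale \<beta>2 (L2 ^ d) + cscale \<beta>3 (L3 ^ d) + cscale \<alpha> (L ^ d)"
    and F3: "F = cscale \<beta>3 (L3 ^ d) + cscale \<alpha> (L ^ d) + cscale \<beta>2 (L2 ^ d)"
    and F': "F = cscale \<alpha> (L ^ d) + cscale \<beta>3 (L3 ^ d) + cscale \<beta>2 (L2 ^ d)"
    and F2': "F = cscale \<beta>2 (L2 ^ d) + cscale \<alpha> (L ^ d) + cscale \<beta>3 (L3 ^ d)"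
    and F3': "F = cscale \<beta>3 (L3 ^ d) + cscale \<beta>2 (L2 ^ d) + cscale \<alpha> (L ^ d)"
    by (simp_all add: F add_ac)
  have perp_L: "cpair P L2 \<noteq> 0" "cpair P L3 \<noteq> 0" if "is_perp P L" for P
    using rank_3_independent[OF d1 r L(1,2,3) F that]
      rank_3_independent[OF d1 r L(1,3,2) F' that] by auto
  have perp_L2: "cpair P L \<noteq> 0" "cpair P L3 \<noteq> 0" if "is_perp P L2" for P
    using rank_3_independent[OF d1 r L(2,1,3) F2' that]
      rank_3_independent[OF d1 r L(2,3,1) F2 that] by auto
  have perp_L3: "cpair P L \<noteq> 0" "cpair P L2 \<noteq> 0" if "is_perp P L3" for P
    using rank_3_independent[OF d1 r L(3,1,2) F3 that]
      rank_3_independent[OF d1 r L(3,2,1) F3' that] by auto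
  have "\<beta>2 \<noteq> 0" "\<beta>3 \<noteq> 0"
    using waring_rank_le_2[OF d1 L(1,3), of F \<alpha> \<beta>3] waring_rank_le_2[OF d1 L(1,2), of F \<alpha> \<beta>2] F r
    by auto
  \<comment> \<open>In degree one, \<open>F\<close> is itself a first power of a linear form.\<close>
  have "d \<noteq> 1"
    using waring_rank_le_2[OF d1, of F F F 1 0] assms(2) r by auto
  with d1 have d: "d \<ge> 2" by simp
  have nz: "L2 \<noteq> 0" "L3 \<noteq> 0"
    using perp_L[OF is_perp_perp[OF L(1) assms(5)]] by (auto simp: cpair_def coeff2_simps)
  have rel: "(\<alpha> - \<mu>) * cpair L L ^ (d - 1) * cpair M L + \<beta>2 * cpair L L2 ^ (d - 1) * cpair M L2
      + \<beta>3 * cpair L L3 ^ (d - 1) * cpair M L3 = 0" if "M \<in> Sym 1" for M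
    using eigenvector_three_powers[OF d L assms(10)[unfolded F] that] by (simp add: algebra_simps)
  \<comment> \<open>This coefficient vanishes if \<open>\<mu> = \<alpha>\<close> and, as \<open>d \<ge> 2\<close>, also if \<open>L\<close> is isotropic.\<close>
  have ne: "(\<alpha> - \<mu>) * cpair L L ^ (d - 1) \<noteq> 0"
  proof
    assume 0: "(\<alpha> - \<mu>) * cpair L L ^ (d - 1) = 0"
    have rel0: "\<beta>2 * cpair L L2 ^ (d - 1) * cpair M L2 + \<beta>3 * cpair L L3 ^ (d - 1) * cpair M L3 = 0"
      if "M \<in> Sym 1" for M
      using rel[OF that] unfolding 0 by simp
    have P2: "is_perp (perp L2) L2" and P3: "is_perp (perp L3) L3"
      using is_perp_perp L nz by auto
    have "cpair L L2 = 0"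
      using rel0[OF perp_in_Sym1, of L3] P3 perp_L3[OF P3] \<open>\<beta>2 \<noteq> 0\<close> by (simp add: is_perp_def)
    moreover have "cpair L L3 = 0"
      using rel0[OF perp_in_Sym1, of L2] P2 perp_L2[OF P2] \<open>\<beta>3 \<noteq> 0\<close> by (simp add: is_perp_def)
    ultimately have "is_perp L L2" "cpair L L3 = 0"
      using L(1) assms(5) by (auto simp: is_perp_def)
    then show False using perp_L2(2) by blast
  qed
  then have neq: "\<alpha> - \<mu> \<noteq> 0" "cpair L L \<noteq> 0" using d by auto
  have G: "F - cscale \<mu> (L ^ d) =
      cscale (\<alpha> - \<mu>) (L ^ d) + cscale \<beta>2 (L2 ^ d) + cscale \<beta>3 (L3 ^ d)"
    by (simp add: F form.scale_left_diff_distrib)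
  have "Ann (F - cscale \<mu> (L ^ d)) = ideal.span {P * P2 * P3, L ^ (d - 1)}"
    if "is_perp P L" "is_perp P2 L2" "is_perp P3 L3" for P P2 P3
    by (rule Ann_three_powers[OF d G L neq(1) \<open>\<beta>2 \<noteq> 0\<close> \<open>\<beta>3 \<noteq> 0\<close> that perp_L[OF that(1)]
      perp_L2[OF that(2)] perp_L3[OF that(3)] L(1) neq(2) rel])
  then show ?thesis using neq by (auto simp: isotropic_def)
qed

end
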